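(* Let $m,n$ be positive integers with $m$ even. Let $\mathbf{c}=(c_1,\dots,c_n)^T\in\mathbb{R}^n$ satisfy $c_{i_1}+c_{i_2}+\cdots+c_{i_m}\neq 0$ for all $i_1,\dots,i_m\in\{1,\dots,n\}$. Let $\mathcal{C}$ be the Cauchy tensor of order $m$ and dimension $n$ generated by $\mathbf{c}$. Then the following statements are equivalent: (i) $\mathcal{C}$ has an SOS tensor decomposition; (ii) $\mathcal{C}$ is positive semi-definite; (iii) $c_i>0$ for all $i\in\{1,\dots,n\}$; (iv) $\mathcal{C}$ is a completely positive tensor.
   Context: A real tensor of order $m$ and dimension $n$ is an array $\mathcal{A}=(a_{i_1\cdots i_m})$ with $i_1,\dots,i_m\in[n]=\{1,\dots,n\}$; it is symmetric if its entries are invariant under permutations of the indices. Its associated form is $f_{\mathcal{A}}(\mathbf{x})=\mathcal{A}\mathbf{x}^m=\sum_{i_1,\dots,i_m\in[n]}a_{i_1\cdots i_m}x_{i_1}\cdots x_{i_m}$, $\mathbf{x}\in\mathbb{R}^n$. A symmetric tensor $\mathcal{A}$ is positive semi-definite if $f_{\mathcal{A}}(\mathbf{x})\ge 0$ for all $\mathbf{x}\in\mathbb{R}^n$. For even $m$, $\mathcal{A}$ has an SOS tensor decomposition if $f_{\mathcal{A}}$ is a finite sum of squares of real polynomials. The Cauchy tensor generated by $\mathbf{c}$ is the symmetric tensor with entries $c_{i_1\cdots i_m}=\frac{1}{c_{i_1}+\cdots+c_{i_m}}$. For $\mathbf{u}\in\mathbb{R}^n$, $\mathbf{u}^m$ denotes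 the rank-one symmetric tensor with entries $u_{i_1}\cdots u_{i_m}$. A tensor $\mathcal{A}$ is completely positive if $\mathcal{A}=\sum_{j=1}^r\mathbf{u}_j^m$ for some $r$ and some vectors $\mathbf{u}_j\in\mathbb{R}^n_+$ (entrywise nonnegative). *)

theory Defs
  imports "HOL-Analysis.Analysis"
begin

text \<open>
  Order and dimension are the cardinalities of the finite index types \<open>'m\<close> and \<open>'n\<close>:
  a multi-index \<open>(i\<^sub>1, \<dots>, i\<^sub>m)\<close> is a function \<open>i :: 'm \<Rightarrow> 'n\<close>, and the tensors of order \<open>CARD('m)\<close>
  and dimension \<open>CARD('n)\<close> form the Euclidean space of real arrays over these multi-indices.
\<close>

type_synonym ('m, 'n) tensor = "(real, 'm \<Rightarrow> 'n) vec"

definition symmetric_tensor :: "('m::finite, 'n::finite) tensor \<Rightarrow> bool" where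
  "symmetric_tensor A \<longleftrightarrow> (\<forall>p. bij p \<longrightarrow> (\<forall>i. A $ (i \<circ> p) = A $ i))"

definition tensor_form :: "('m::finite, 'n::finite) tensor \<Rightarrow> real ^ 'n \<Rightarrow> real" where
  "tensor_form A x = (\<Sum>i\<in>UNIV. A $ i * (\<Prod>k\<in>UNIV. x $ i k))"

definition psd_tensor :: "('m::finite, 'n::finite) tensor \<Rightarrow> bool" where
  "psd_tensor A \<longleftrightarrow> symmetric_tensor A \<and> (\<forall>x. 0 \<le> tensor_form A x)"

text \<open>
  Polynomials in the coordinates of \<open>real ^ 'n\<close> are represented by the functions they induce,
  which determine them because the real field is infinite.  On this finite-dimensional space the
  bounded linear functionals generating \<^const>\<open>real_polynomial_function\<close> are exactly the linear
  forms in the coordinates.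
\<close>

definition sos_tensor :: "('m::finite, 'n::finite) tensor \<Rightarrow> bool" where
  "sos_tensor A \<longleftrightarrow>
     (\<exists>(r::nat) (p :: nat \<Rightarrow> real ^ 'n \<Rightarrow> real).
        (\<forall>j<r. real_polynomial_function (p j)) \<and>
        (\<forall>x. tensor_form A x = (\<Sum>j<r. (p j x)\<^sup>2)))"

definition cauchy_tensor :: "real ^ 'n \<Rightarrow> ('m::finite, 'n::finite) tensor" where
  "cauchy_tensor c = (\<chi> i. 1 / (\<Sum>k\<in>UNIV. c $ i k))"

definition rank_one_tensor :: "real ^ 'n \<Rightarrow> ('m::finite, 'n::finite) tensor" where
  "rank_one_tensor u = (\<chi> i. \<Prod>k\<in>UNIV. u $ i k)"

definition completely_positive_tensor :: "('m::finite, 'n::finite) tensor \<Rightarrow> bool" where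
  "completely_positive_tensor A \<longleftrightarrow>
     (\<exists>(r::nat) (u :: nat \<Rightarrow> real ^ 'n).
        (\<forall>j<r. \<forall>l. 0 \<le> u j $ l) \<and> A = (\<Sum>j<r. rank_one_tensor (u j)))"

lemma symmetric_cauchy_tensor: "symmetric_tensor (cauchy_tensor c)"
  by (auto simp: symmetric_tensor_def cauchy_tensor_def intro!: arg_cong[where f = "\<lambda>s. 1 / s"]
      sum.reindex_bij_betw)

end

theory Submission
  imports Defs
begin

text \<open>
  The implication from positive generators to complete positivity rests on
  \<open>1 / (\<Sum>k. c\<^bsub>i k\<^esub>) = \<integral> N * s powr (N * (\<Sum>k. c\<^bsub>i k\<^esub>) - 1)\<close> over \<open>{0..1}\<close>, whose integrand is \<open>N\<close> times
  the rank-one tensor of the vector with entries \<open>s powr (N * c\<^bsub>l\<^esub> - 1 / m)\<close>.  For large \<open>N\<close> this is a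
  continuous curve on a compact interval, so its mean lies in the convex hull of its image, and
  no closedness of the cone of completely positive tensors is needed.  Conversely, the form of
  \<open>u\<^sup>m\<close> is the square \<open>((u \<bullet> x) ^ (m div 2))\<^sup>2\<close>, and evaluating a nonnegative form at the unit
  vectors yields \<open>1 / (m * c\<^bsub>l\<^esub>) \<ge> 0\<close>.
\<close>

text \<open>Distributing the \<open>m\<close>-fold product of the sum \<open>u \<bullet> x\<close>
  produces exactly one term per multi-index.\<close>

lemma tensor_form_rank_one:
  "tensor_form (rank_one_tensor u :: ('m::finite, 'n::finite) tensor) x = (u \<bullet> x) ^ CARD('m)"
proof -
  have "(u \<bullet> x) ^ CARD('m) = (\<Prod>k\<in>(UNIV::'m set). \<Sum>l\<in>(UNIV::'n set). u $ l * x $ l)"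
    by (simp add: inner_vec_def)
  also have "\<dots> = (\<Sum>i\<in>PiE (UNIV::'m set) (\<lambda>_. UNIV::'n set). \<Prod>k\<in>UNIV. u $ i k * x $ i k)"
    by (rule prod_sum_PiE) auto
  finally show ?thesis
    by (simp add: tensor_form_def rank_one_tensor_def prod.distrib PiE_UNIV_domain)
qed

lemma tensor_form_sum:
  "tensor_form (\<Sum>j\<in>S. A j) x = (\<Sum>j\<in>S. tensor_form (A j) x)"
  unfolding tensor_form_def sum_component sum_distrib_right by (rule sum.swap)

lemma tensor_form_axis:
  "tensor_form (A :: ('m::finite, 'n::finite) tensor) (axis l 1) = A $ (\<lambda>_. l)"
proof -
  have prod_axis: "(\<Prod>k\<in>UNIV. axis l (1::real) $ i k) = (if i = (\<lambda>_. l) then 1 else 0)"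
    for i :: "'m \<Rightarrow> 'n"
  proof (cases "i = (\<lambda>_. l)")
    case False
    then obtain k where "i k \<noteq> l" by blast
    then have "(\<Prod>k\<in>UNIV. axis l (1::real) $ i k) = 0"
      by (intro prod_zero) (auto simp: axis_def)
    with False show ?thesis by simp
  qed simp
  have "tensor_form A (axis l 1) = (\<Sum>i\<in>UNIV. if i = (\<lambda>_. l) then A $ i else 0)"
    unfolding tensor_form_def prod_axis by (intro sum.cong) auto
  then show ?thesis
    by simp
qed

text \<open>An enumeration of \<open>S\<close> supplies the natural-number indexing of the
  definition; a convex hull yields sums over a finite set of tensors instead.\<close>

lemma completely_positive_sumI:
  fixes u :: "'b \<Rightarrow> real ^ 'n::finite"
  assumes "finite S" and "\<And>j l. j \<in> S \<Longrightarrow> 0 \<le> u j $ l"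
  shows "completely_positive_tensor (\<Sum>j\<in>S. rank_one_tensor (u j) :: ('m::finite, 'n) tensor)"
proof -
  obtain h where h: "bij_betw h {0..<card S} S"
    using ex_bij_betw_nat_finite[OF \<open>finite S\<close>] by blast
  have "(\<Sum>j\<in>S. rank_one_tensor (u j) :: ('m, 'n) tensor) = (\<Sum>j<card S. rank_one_tensor (u (h j)))"
    using sum.reindex_bij_betw[OF h, of "\<lambda>j. rank_one_tensor (u j) :: ('m, 'n) tensor"]
    by (simp add: atLeast0LessThan)
  moreover have "\<forall>j<card S. \<forall>l. 0 \<le> u (h j) $ l"
    using assms(2) bij_betwE[OF h] by auto
  ultimately show ?thesis
    unfolding completely_positive_tensor_def
    by (intro exI[of _ "card S"] exI[of _ "\<lambda>j. u (h j)"] conjI)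
qed

text \<open>Each entry of the rank-one tensor has \<open>m\<close> factors, so a nonnegative weight
  is absorbed by its \<open>m\<close>-th root.\<close>

lemma scaleR_rank_one_tensor:
  assumes "0 \<le> a"
  shows "a *\<^sub>R (rank_one_tensor u :: ('m::finite, 'n::finite) tensor) =
    rank_one_tensor (root CARD('m) a *\<^sub>R u)"
  using assms by (simp add: rank_one_tensor_def vec_eq_iff prod.distrib)

lemma completely_positive_convex_hull:
  assumes "A \<in> convex hull (rank_one_tensor ` {u. \<forall>l. 0 \<le> u $ l} :: ('m::finite, 'n::finite) tensor set)"
  shows "completely_positive_tensor A"
proof -
  obtain S w where S: "finite S" "S \<subseteq> rank_one_tensor ` {u. \<forall>l. 0 \<le> u $ l}"
    and w: "\<forall>B\<in>S. 0 \<le> w B" and A: "(\<Sum>B\<in>S. w B *\<^sub>R B) = A"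
    using assms unfolding convex_hull_explicit by blast
  have "\<forall>B\<in>S. \<exists>u. (\<forall>l. 0 \<le> u $ l) \<and> B = rank_one_tensor u"
    using S(2) by blast
  then obtain u where u: "\<forall>B\<in>S. (\<forall>l. 0 \<le> u B $ l) \<and> B = rank_one_tensor (u B)"
    by metis
  have "A = (\<Sum>B\<in>S. rank_one_tensor (root CARD('m) (w B) *\<^sub>R u B))"
    unfolding A[symmetric] using u w by (intro sum.cong) (auto simp flip: scaleR_rank_one_tensor)
  also have "completely_positive_tensor \<dots>"
    using S(1) u w by (intro completely_positive_sumI) auto
  finally show ?thesis .
qed

text \<open>The hull of the compact image is compact, so a point outside it is strictly separated by
  some \<open>a\<close> and \<open>b\<close>. Integrating \<open>b \<le> a \<bullet> f s\<close>
  over an interval of length 1 contradicts \<open>a \<bullet> I < b\<close>.\<close>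

lemma integral_in_convex_hull:
  fixes f :: "real \<Rightarrow> 'a::euclidean_space"
  assumes "continuous_on {0..1} f" and I: "(f has_integral I) {0..1}"
  shows "I \<in> convex hull (f ` {0..1})"
proof (rule ccontr)
  assume "I \<notin> convex hull (f ` {0..1})"
  moreover have "closed (convex hull (f ` {0..1}))"
    using assms(1) by (intro compact_imp_closed compact_convex_hull compact_continuous_image) auto
  ultimately obtain a b where ab: "a \<bullet> I < b" "\<forall>x\<in>convex hull (f ` {0..1}). b < a \<bullet> x"
    using separating_hyperplane_closed_point[OF convex_convex_hull] by blast
  have "((\<lambda>s. b) has_integral b) {0..1::real}"
    using has_integral_const_real[of b 0 1] by simp
  moreover have "((\<lambda>s. a \<bullet> f s) has_integral a \<bullet> I) {0..1}"
    using has_integral_linear[OF I bounded_linear_inner_right[of a]] by (simp add: o_def)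
  moreover have "b \<le> a \<bullet> f s" if "s \<in> {0..1}" for s
  proof -
    have "f s \<in> convex hull (f ` {0..1})"
      using that by (intro hull_inc imageI)
    with ab(2) show ?thesis
      by (intro less_imp_le) (rule bspec)
  qed
  ultimately have "b \<le> a \<bullet> I"
    by (rule has_integral_le)
  with ab(1) show False by simp
qed

lemma has_integral_vec:
  fixes f :: "'a::euclidean_space \<Rightarrow> real ^ 'b::finite"
  assumes "\<And>i. ((\<lambda>x. f x $ i) has_integral I $ i) S"
  shows "(f has_integral I) S"
  using assms by (subst has_integral_componentwise_iff) (auto simp: Basis_vec_def inner_axis)

lemma cauchy_tensor_completely_positive:
  fixes c :: "real ^ 'n::finite"
  assumes c: "\<forall>l. 0 < c $ l"
  shows "completely_positive_tensor (cauchy_tensor c :: ('m::finite, 'n) tensor)"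
proof -
  define m where "m = real CARD('m)"
  define d where "d = Min (range (($) c))"
  \<comment> \<open>This makes \<open>N * c $ l\<close> at least 2, which exceeds
    \<open>1 / m\<close>. All exponents \<open>e l\<close> are then positive, as continuity at
    \<open>s = 0\<close> requires.\<close>
  define N where "N = 2 / d"
  \<comment> \<open>The exponent -1 of the integrand is shared equally among the \<open>m\<close>
    factors.\<close>
  define e where "e l = N * c $ l - 1 / m" for l
  have m: "1 \<le> m"
    unfolding m_def by (simp add: Suc_leI)
  have d: "0 < d" "d \<le> c $ l" for l
    using c by (auto simp: d_def)
  then have N: "0 < N"
    by (simp add: N_def)
  have e: "0 < e l" for l
  proof -
    have "1 / m < 2" using m by (simp add: field_simps)
    also have "2 \<le> N * c $ l" using d by (simp add: N_def field_simps)
    finally show ?thesis by (simp add: e_def)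
  qed
  define v :: "real \<Rightarrow> real ^ 'n" where "v s = root CARD('m) N *\<^sub>R (\<chi> l. s powr e l)" for s
  define g :: "real \<Rightarrow> ('m, 'n) tensor" where "g s = rank_one_tensor (v s)" for s
  have g: "g s $ i = N * s powr (N * (\<Sum>k\<in>UNIV. c $ i k) - 1)" if "0 \<le> s" for s i
  proof -
    have "(\<Sum>k\<in>UNIV. e (i k)) = N * (\<Sum>k\<in>UNIV. c $ i k) - 1"
      using m by (simp add: e_def sum_subtractf sum_distrib_left m_def)
    moreover have "(\<Prod>k\<in>UNIV. s powr e (i k)) = s powr (\<Sum>k\<in>UNIV. e (i k))"
      \<comment> \<open>At \<open>s = 0\<close> both sides vanish, since \<open>0 powr x = 0\<close>
        for every \<open>x\<close> and the product is nonempty.\<close>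
      using that by (cases "s = 0") (simp_all add: powr_sum power_0_left)
    ultimately show ?thesis
      using N by (simp add: g_def v_def rank_one_tensor_def prod.distrib)
  qed
  have "continuous_on {0..1} g"
    unfolding g_def v_def rank_one_tensor_def using e
    by (auto intro!: continuous_intros continuous_on_powr')
  moreover have "(g has_integral cauchy_tensor c) {0..1}"
  proof (rule has_integral_vec)
    fix i :: "'m \<Rightarrow> 'n"
    let ?s = "\<Sum>k\<in>UNIV. c $ i k"
    have "0 < ?s"
      using c by (intro sum_pos) auto
    then have "0 < N * ?s"
      using N by simp
    then have "((\<lambda>s. s powr (N * ?s - 1)) has_integral 1 / (N * ?s)) {0..1}"
      using has_integral_powr_from_0[of "N * ?s - 1" 1] by simp
    from has_integral_mult_right[OF this, of N]
    have "((\<lambda>s. N * s powr (N * ?s - 1)) has_integral cauchy_tensor c $ i) {0..1}"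
      using N by (simp add: cauchy_tensor_def)
    then show "((\<lambda>s. g s $ i) has_integral cauchy_tensor c $ i) {0..1}"
      by (rule has_integral_eq[rotated]) (simp add: g)
  qed
  ultimately have "cauchy_tensor c \<in> convex hull (g ` {0..1})"
    by (rule integral_in_convex_hull)
  also have "\<dots> \<subseteq> convex hull (rank_one_tensor ` {u. \<forall>l. 0 \<le> u $ l})"
    using N by (intro hull_mono) (auto simp: g_def v_def)
  finally show ?thesis
    by (rule completely_positive_convex_hull)
qed

lemma completely_positive_imp_sos:
  fixes A :: "('m::finite, 'n::finite) tensor"
  assumes "even CARD('m)" and "completely_positive_tensor A"
  shows "sos_tensor A"
proof -
  obtain r and u :: "nat \<Rightarrow> real ^ 'n" where A: "A = (\<Sum>j<r. rank_one_tensor (u j))"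
    using assms(2) unfolding completely_positive_tensor_def by blast
  let ?p = "\<lambda>j x. (u j \<bullet> x) ^ (CARD('m) div 2)"
  have "real_polynomial_function (?p j)" for j
    by (intro real_polynomial_function_power real_polynomial_function.intros(1)
        bounded_linear_inner_right)
  moreover have "tensor_form A x = (\<Sum>j<r. (?p j x)\<^sup>2)" for x
    using assms(1) by (simp add: A tensor_form_sum tensor_form_rank_one flip: power_mult)
  ultimately show ?thesis
    unfolding sos_tensor_def by (intro exI[of _ r] exI[of _ ?p]) simp
qed

lemma psd_cauchy_imp_pos:
  fixes c :: "real ^ 'n::finite"
  assumes "\<forall>i :: 'm \<Rightarrow> 'n. (\<Sum>k\<in>UNIV. c $ i k) \<noteq> 0"
    and "psd_tensor (cauchy_tensor c :: ('m::finite, 'n) tensor)"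
  shows "0 < c $ l"
proof -
  have "0 \<le> tensor_form (cauchy_tensor c :: ('m, 'n) tensor) (axis l 1)"
    using assms(2) by (simp add: psd_tensor_def)
  \<comment> \<open>Nonnegativity alone would admit \<open>c $ l = 0\<close>, because
    \<open>1 / 0 = 0\<close>; the constant multi-index excludes this.\<close>
  moreover have "c $ l \<noteq> 0"
    using assms(1)[rule_format, of "\<lambda>_. l"] by simp
  ultimately show ?thesis
    by (simp add: tensor_form_axis cauchy_tensor_def zero_le_divide_iff zero_le_mult_iff)
qed

theorem theorem3p1:
  fixes c :: "real ^ 'n::finite"
    and C :: "('m::finite, 'n) tensor"
  assumes "even CARD('m)"
    and "\<forall>i :: 'm \<Rightarrow> 'n. (\<Sum>k\<in>UNIV. c $ i k) \<noteq> 0"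
    and "C = cauchy_tensor c"
  shows "(sos_tensor C \<longleftrightarrow> psd_tensor C) \<and>
    (psd_tensor C \<longleftrightarrow> (\<forall>i. 0 < c $ i)) \<and>
    ((\<forall>i. 0 < c $ i) \<longleftrightarrow> completely_positive_tensor C)"
proof -
  \<comment> \<open>The four implications form a cycle. Here a sum of squares gives only the sign of
    the form; symmetry comes from the Cauchy structure.\<close>
  have "psd_tensor C" if "sos_tensor C"
    using that symmetric_cauchy_tensor assms(3)
    by (auto simp: sos_tensor_def psd_tensor_def intro!: sum_nonneg)
  moreover have "\<forall>i. 0 < c $ i" if "psd_tensor C"
    using that psd_cauchy_imp_pos assms(2,3) by blast
  moreover have "completely_positive_tensor C" if "\<forall>i. 0 < c $ i"
    using that cauchy_tensor_completely_positive assms(3) by blast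
  moreover have "sos_tensor C" if "completely_positive_tensor C"
    using that completely_positive_imp_sos assms(1) by blast
  ultimately show ?thesis
    by blast
qed

end
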